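(* Let $n\ge1$ and $A\in M_n(\mathbb{C})$. The function $G(\cdot;A):\mathbb{C}\to\mathbb{C}$, $G(z;A)=\sum_{r=0}^{n-1}\Lambda_r(A)\,e^{2\pi i r z/n}$, satisfies: (1) $G(k;A)=G_k(A)$ for $k=0,1,\dots,n-1$; (2) $G(z+n;A)=G(z;A)$ for all $z\in\mathbb{C}$; (3) $G(\cdot;A)$ is an entire function on $\mathbb{C}$; (4) $|G(z;A)|\le C_A\,e^{2\pi(n-1)|\mathrm{Im}\,z|/n}$ for all $z\in\mathbb{C}$, where $C_A=\sum_{r=0}^{n-1}|\Lambda_r(A)|$.
   Context: Let $\omega=e^{2\pi i/n}$, let $S_n$ be the symmetric group on $\{1,\dots,n\}$ with composition $(\sigma\circ\tau)(i)=\sigma(\tau(i))$, let $\varepsilon(\sigma)$ be the sign of $\sigma$, and let $\rho=(1\,2\,\cdots\,n)$ be the cycle $\rho(i)=i+1$ for $i<n$, $\rho(n)=1$. Each orbit $\{\sigma\circ\rho^r: r\in\mathbb{Z}/n\mathbb{Z}\}$ contains exactly one permutation $\sigma^*$ with $\sigma^*(1)=1$. The orbital phase $\phi:S_n\to\mathbb{Z}/n\mathbb{Z}$ is the unique function such that $\phi(\sigma^*\circ\rho^r)=r$ for every $\sigma^*\in S_n$ with $\sigma^*(1)=1$ and every $r$. For $A=(a_{ij})\in M_n(\mathbb{C})$ put $m_\sigma(A)=\varepsilon(\sigma)\prod_{i=1}^n a_{i,\sigma(i)}$, $\Lambda_r(A)=\sum_{\sigma:\phi(\sigma)=r}m_\sigma(A)$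 for $r=0,\dots,n-1$, and $G_k(A)=\sum_{r=0}^{n-1}\Lambda_r(A)\omega^{kr}$ for $k=0,\dots,n-1$. *)

theory Defs
  imports
    "HOL-Complex_Analysis.Complex_Analysis"
    "HOL-Combinatorics.Permutations"
    "HOL-Library.FuncSet"
    "Jordan_Normal_Form.Matrix"
begin

text \<open>\<open>S\<^sub>n\<close> is the set of functions that permute \<open>{1..n}\<close>, and \<open>\<int>/n\<int>\<close> is represented by the
  residues \<open>{..<n}\<close>.\<close>

definition rho :: "nat \<Rightarrow> nat \<Rightarrow> nat" where
  "rho n i = (if 1 \<le> i \<and> i < n then i + 1 else if i = n then 1 else i)"

text \<open>The extensional function space fixes the values outside \<open>S\<^sub>n\<close>; without it the orbital
  phase would not be unique as a function on the whole type.\<close>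

definition is_orbital_phase :: "nat \<Rightarrow> ((nat \<Rightarrow> nat) \<Rightarrow> nat) \<Rightarrow> bool" where
  "is_orbital_phase n f \<longleftrightarrow>
     f \<in> {\<sigma>. \<sigma> permutes {1..n}} \<rightarrow>\<^sub>E {..<n} \<and>
     (\<forall>\<tau> r. \<tau> permutes {1..n} \<and> \<tau> 1 = 1 \<and> r < n \<longrightarrow> f (\<tau> \<circ> (rho n ^^ r)) = r)"

definition orbital_phase :: "nat \<Rightarrow> (nat \<Rightarrow> nat) \<Rightarrow> nat" where
  "orbital_phase n = (THE f. is_orbital_phase n f)"

text \<open>Matrices of the library are indexed from \<open>0\<close>, so the entry \<open>a\<^sub>i\<^sub>j\<close> with \<open>i, j \<in> {1..n}\<close>
  is \<open>A $$ (i - 1, j - 1)\<close>.\<close>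

definition monomial_term :: "nat \<Rightarrow> complex mat \<Rightarrow> (nat \<Rightarrow> nat) \<Rightarrow> complex" where
  "monomial_term n A \<sigma> = of_int (sign \<sigma>) * (\<Prod>i = 1..n. A $$ (i - 1, \<sigma> i - 1))"

definition Lambda :: "nat \<Rightarrow> complex mat \<Rightarrow> nat \<Rightarrow> complex" where
  "Lambda n A r =
     (\<Sum>\<sigma> | \<sigma> permutes {1..n} \<and> orbital_phase n \<sigma> = r. monomial_term n A \<sigma>)"

definition omega :: "nat \<Rightarrow> complex" where
  "omega n = exp (2 * of_real pi * \<i> / of_nat n)"

definition G_dft :: "nat \<Rightarrow> complex mat \<Rightarrow> nat \<Rightarrow> complex" where
  "G_dft n A k = (\<Sum>r<n. Lambda n A r * omega n ^ (k * r))"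

definition G_ext :: "nat \<Rightarrow> complex mat \<Rightarrow> complex \<Rightarrow> complex" where
  "G_ext n A z = (\<Sum>r<n. Lambda n A r * exp (2 * of_real pi * \<i> * of_nat r * z / of_nat n))"

definition C_const :: "nat \<Rightarrow> complex mat \<Rightarrow> real" where
  "C_const n A = (\<Sum>r<n. norm (Lambda n A r))"

lemma rho_funpow:
  assumes "i \<in> {1..n}"
  shows "(rho n ^^ r) i = (i - 1 + r) mod n + 1"
proof (induction r)
  case 0
  then show ?case using assms by auto
next
  case (Suc r)
  have "n > 0" using assms by auto
  then have lt: "(i - 1 + r) mod n < n" by simp
  have "(rho n ^^ Suc r) i = rho n ((i - 1 + r) mod n + 1)" using Suc by simp
  also have "\<dots> = (i - 1 + Suc r) mod n + 1"
    using lt by (auto simp: rho_def mod_Suc)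
  finally show ?case .
qed

lemma rho_permutes:
  assumes "n \<ge> 1"
  shows "rho n permutes {1..n}"
proof (rule bij_imp_permutes)
  have "inj_on (rho n) {1..n}"
    by (auto simp: inj_on_def rho_def split: if_splits)
  moreover have "rho n ` {1..n} \<subseteq> {1..n}"
    using assms by (auto simp: rho_def)
  ultimately show "bij_betw (rho n) {1..n} {1..n}"
    by (simp add: bij_betw_def endo_inj_surj)
  show "rho n x = x" if "x \<notin> {1..n}" for x
    using that assms by (auto simp: rho_def)
qed

lemma rho_funpow_permutes:
  assumes "n \<ge> 1"
  shows "(rho n ^^ r) permutes {1..n}"
proof (induction r)
  case 0
  then show ?case by (simp add: permutes_id[unfolded id_def] id_def)
next
  case (Suc r)
  then show ?case
    using permutes_compose[OF Suc rho_permutes[OF assms]] by (simp only: funpow.simps(2))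
qed

lemma orbit_decomposition:
  assumes "n \<ge> 1" and \<sigma>: "\<sigma> permutes {1..n}"
  shows "\<exists>\<tau> r. \<tau> permutes {1..n} \<and> \<tau> 1 = 1 \<and> r < n \<and> \<sigma> = \<tau> \<circ> (rho n ^^ r)"
proof -
  obtain j where j: "j \<in> {1..n}" "\<sigma> j = 1"
    using permutes_image[OF \<sigma>] assms(1) by (metis atLeastAtMost_iff imageE order_refl)
  define r where "r = (n - (j - 1)) mod n"
  have r: "r < n" using assms(1) by (simp add: r_def)
  have "(j - 1 + r) mod n = (j - 1 + (n - (j - 1))) mod n"
    by (simp add: r_def mod_add_right_eq)
  also have "\<dots> = 0" using j by auto
  finally have pj: "(rho n ^^ r) j = 1" using rho_funpow[OF j(1)] by simp
  let ?p = "rho n ^^ r"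
  have p: "?p permutes {1..n}" by (rule rho_funpow_permutes[OF assms(1)])
  define \<tau> where "\<tau> = \<sigma> \<circ> inv_into UNIV ?p"
  have "\<tau> permutes {1..n}"
    unfolding \<tau>_def by (intro permutes_compose permutes_inv p \<sigma>)
  moreover have "\<tau> 1 = 1"
    using permutes_inverses(2)[OF p, of j] pj j by (simp add: \<tau>_def)
  moreover have "\<sigma> = \<tau> \<circ> ?p"
    using permutes_inv_o(2)[OF p] by (simp add: \<tau>_def comp_assoc)
  ultimately show ?thesis using r by blast
qed

lemma orbit_decomposition_unique:
  assumes "n \<ge> 1" "\<tau> permutes {1..n}" "\<tau> 1 = 1" "r < n"
    and "\<tau>' permutes {1..n}" "\<tau>' 1 = 1" "r' < n"
    and eq: "\<tau> \<circ> (rho n ^^ r) = \<tau>' \<circ> (rho n ^^ r')"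
  shows "r = r'"
proof -
  obtain j where j: "j \<in> {1..n}" "(rho n ^^ r) j = 1"
    using permutes_image[OF rho_funpow_permutes[OF assms(1), of r]] assms(1)
    by (metis atLeastAtMost_iff imageE order_refl)
  have "\<tau>' ((rho n ^^ r') j) = \<tau>' 1"
    using fun_cong[OF eq, of j] j(2) assms(3,6) by (simp only: comp_apply)
  then have "(rho n ^^ r') j = 1"
    using permutes_inj[OF assms(5)] by (auto dest: injD)
  then have "(j - 1 + r) mod n = (j - 1 + r') mod n"
    using j rho_funpow[OF j(1)] by simp
  then have "(n - (j - 1) + (j - 1 + r)) mod n = (n - (j - 1) + (j - 1 + r')) mod n"
    by (metis mod_add_right_eq)
  moreover have "n - (j - 1) + (j - 1 + s) = n + s" for s
    using j(1) by auto
  ultimately have "r mod n = r' mod n" by simp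
  then show ?thesis using assms by simp
qed

lemma ex1_orbital_phase:
  assumes "n \<ge> 1"
  shows "\<exists>!f. is_orbital_phase n f"
proof -
  let ?S = "{\<sigma>. \<sigma> permutes {1..n}}"
  let ?P = "\<lambda>\<sigma> r. r < n \<and> (\<exists>\<tau>. \<tau> permutes {1..n} \<and> \<tau> 1 = 1 \<and> \<sigma> = \<tau> \<circ> (rho n ^^ r))"
  have ex: "\<exists>!r. ?P \<sigma> r" if "\<sigma> \<in> ?S" for \<sigma>
    using orbit_decomposition[OF assms, of \<sigma>] orbit_decomposition_unique[OF assms] that
    by (metis mem_Collect_eq)
  define f where "f = restrict (\<lambda>\<sigma>. THE r. ?P \<sigma> r) ?S"
  have f: "?P \<sigma> (f \<sigma>)" if "\<sigma> \<in> ?S" for \<sigma>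
    using theI'[OF ex[OF that]] that by (simp add: f_def)
  have "is_orbital_phase n f"
    unfolding is_orbital_phase_def
  proof (intro conjI allI impI)
    show "f \<in> ?S \<rightarrow>\<^sub>E {..<n}"
      using f by (auto simp: f_def)
  next
    fix \<tau> r assume *: "\<tau> permutes {1..n} \<and> \<tau> 1 = 1 \<and> r < n"
    then have S: "\<tau> \<circ> (rho n ^^ r) \<in> ?S"
      using permutes_compose[OF rho_funpow_permutes[OF assms]] by blast
    show "f (\<tau> \<circ> (rho n ^^ r)) = r"
      using ex[OF S] f[OF S] * by blast
  qed
  moreover have "g = f" if g: "is_orbital_phase n g" for g
  proof
    fix \<sigma>
    show "g \<sigma> = f \<sigma>"
    proof (cases "\<sigma> \<in> ?S")
      case True
      with f[OF True] g show ?thesis unfolding is_orbital_phase_def by metis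
    next
      case False
      with g show ?thesis
        by (auto simp: is_orbital_phase_def f_def PiE_def extensional_def)
    qed
  qed
  ultimately show ?thesis by blast
qed

lemma is_orbital_phase_orbital_phase:
  "n \<ge> 1 \<Longrightarrow> is_orbital_phase n (orbital_phase n)"
  unfolding orbital_phase_def by (rule theI'[OF ex1_orbital_phase])

end

theory Submission imports Defs begin

text \<open>\<open>G_ext n A\<close> is a trigonometric polynomial with the \<open>n\<close> frequencies \<open>r / n\<close>, \<open>r < n\<close>, so each
  claim reduces to one on a single mode \<open>exp (2 \<pi> \<i> r z / n)\<close>: at a natural number \<open>k\<close> it equals
  \<open>\<omega>\<^bsup>kr\<^esup>\<close>; a shift of \<open>z\<close> by \<open>n\<close> multiplies it by \<open>exp (2 \<pi> \<i> r) = 1\<close>; it is entire; and its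
  modulus is \<open>exp (-2 \<pi> r Im z / n)\<close>, in which \<open>0 \<le> r \<le> n - 1\<close>. The growth bound follows by the
  triangle inequality.\<close>

lemma exp_mode_of_nat:
  "exp (2 * of_real pi * \<i> * of_nat r * of_nat k / of_nat n) = omega n ^ (k * r)"
proof -
  have "2 * of_real pi * \<i> * of_nat r * of_nat k / of_nat n
      = of_nat (k * r) * (2 * of_real pi * \<i> / of_nat n)"
    by simp
  then show ?thesis
    unfolding omega_def by (simp only: exp_of_nat_mult)
qed

lemma exp_mode_periodic:
  assumes "n \<ge> 1"
  shows "exp (2 * of_real pi * \<i> * of_nat r * (z + of_nat n) / of_nat n)
       = exp (2 * of_real pi * \<i> * of_nat r * z / of_nat n)"
proof -
  have "2 * of_real pi * \<i> * of_nat r * (z + of_nat n) / of_nat n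
      = 2 * of_real pi * \<i> * of_nat r * z / of_nat n
        + of_nat r * (2 * of_real pi * \<i>)"
    using assms by (simp add: field_simps)
  moreover have "exp (of_nat r * (2 * of_real pi * \<i>)) = (1::complex)"
    by (simp only: exp_of_nat_mult exp_two_pi_i power_one)
  ultimately show ?thesis
    by (simp only: exp_add mult_1_right)
qed

lemma norm_exp_mode_le:
  assumes "r < n"
  shows "norm (exp (2 * of_real pi * \<i> * of_nat r * z / of_nat n))
       \<le> exp (2 * pi * (real n - 1) * \<bar>Im z\<bar> / real n)"
proof -
  have "Re (2 * of_real pi * \<i> * of_nat r * z / of_nat n) = 2 * pi * (real r * - Im z) / real n"
    by (simp add: Re_divide_of_nat)
  also have "\<dots> \<le> 2 * pi * ((real n - 1) * \<bar>Im z\<bar>) / real n"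
  proof -
    have "real r * - Im z \<le> real r * \<bar>Im z\<bar>"
      by (intro mult_left_mono) auto
    also have "\<dots> \<le> (real n - 1) * \<bar>Im z\<bar>"
      using assms by (intro mult_right_mono) auto
    finally show ?thesis
      by (intro divide_right_mono mult_left_mono) auto
  qed
  finally show ?thesis
    by (simp add: mult.assoc)
qed

theorem theorem10p2:
  fixes n :: nat and A :: "complex mat"
  assumes "n \<ge> 1" and "A \<in> carrier_mat n n"
  shows "(\<forall>k<n. G_ext n A (of_nat k) = G_dft n A k) \<and>
         (\<forall>z. G_ext n A (z + of_nat n) = G_ext n A z) \<and>
         G_ext n A holomorphic_on UNIV \<and>
         (\<forall>z. norm (G_ext n A z)
                \<le> C_const n A * exp (2 * pi * (real n - 1) * \<bar>Im z\<bar> / real n))"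
proof (intro conjI allI impI)
  show "G_ext n A (of_nat k) = G_dft n A k" for k
    unfolding G_ext_def G_dft_def by (simp only: exp_mode_of_nat)
  show "G_ext n A (z + of_nat n) = G_ext n A z" for z
    unfolding G_ext_def by (simp only: exp_mode_periodic[OF assms(1)])
  show "G_ext n A holomorphic_on UNIV"
    unfolding G_ext_def[abs_def] using assms(1) by (intro holomorphic_intros) auto
  show "norm (G_ext n A z) \<le> C_const n A * exp (2 * pi * (real n - 1) * \<bar>Im z\<bar> / real n)" for z
    unfolding G_ext_def C_const_def sum_distrib_right
    by (intro sum_norm_le) (auto simp only: norm_mult lessThan_iff
        intro!: mult_left_mono norm_exp_mode_le norm_ge_zero)
qed

end
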